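(* Let $k$ be a positive integer and let $G(x,k)=\sum_{n=0}^{\infty}M_n^{(k)}x^n$ be the ordinary generating function (a formal power series in $x$) of the higher order Mersenne sequence. Then $$G(x,k)=\frac{x}{(x-1)(2^kx-1)} .$$
   Context: The Mersenne numbers $\{M_n\}_{n\ge 0}$ are defined by $M_0=0$, $M_1=1$, $M_{n+2}=3M_{n+1}-2M_n$, i.e. $M_n=2^n-1$. For a positive integer $k$, the higher order Mersenne numbers are $M_n^{(k)}=M_{kn}/M_k$ for $n=0,1,2,\dots$. *)

theory Defs
  imports "HOL-Computational_Algebra.Formal_Power_Series"
begin

text \<open>The recurrence subtracts, so the sequence is integer-valued rather than over \<open>nat\<close>.\<close>

fun mersenne :: "nat \<Rightarrow> int" where
  "mersenne 0 = 0"
| "mersenne (Suc 0) = 1"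
| "mersenne (Suc (Suc n)) = 3 * mersenne (Suc n) - 2 * mersenne n"

text \<open>The quotient is taken in the rationals, so that it is the genuine quotient and not a
  truncated one. It is meant for \<open>k > 0\<close>; for \<open>k = 0\<close> it is the junk value \<open>0\<close>.\<close>

definition higher_mersenne :: "nat \<Rightarrow> nat \<Rightarrow> rat" where
  "higher_mersenne k n = of_int (mersenne (k * n)) / of_int (mersenne k)"

definition higher_mersenne_gf :: "nat \<Rightarrow> rat fps" where
  "higher_mersenne_gf k = Abs_fps (higher_mersenne k)"

end

theory Submission
  imports Defs
begin

text \<open>With c = 2^k, the sequence is (c^n - 1)/(c - 1), a combination of the powers of 1 and c.
  It therefore obeys the linear recurrence with characteristic roots 1 and c
  (\<open>higher_mersenne_Suc_Suc\<close>). Multiplying the series by (x - 1)(c x - 1) = c x^2 - (c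
  + 1) x + 1 kills every coefficient from degree 2 on, and the initial values 0 and 1 leave just x
  (\<open>higher_mersenne_gf_mult\<close>). Cancelling the polynomial gives the quotient.\<close>

lemma mersenne_eq: "mersenne n = 2 ^ n - 1"
  by (induction n rule: mersenne.induct) simp_all

lemma higher_mersenne_eq: "higher_mersenne k n = ((2 ^ k) ^ n - 1) / (2 ^ k - 1)"
  by (simp add: higher_mersenne_def mersenne_eq power_mult)

lemma higher_mersenne_Suc_Suc:
  "higher_mersenne k (Suc (Suc n))
    = (2 ^ k + 1) * higher_mersenne k (Suc n) - 2 ^ k * higher_mersenne k n"
  \<comment> \<open>Over the common denominator only the numerators are compared, so this also
    covers \<open>k = 0\<close>, where division by 0 gives 0.\<close>
  unfolding higher_mersenne_eq times_divide_eq_right diff_divide_distrib [symmetric]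
  by (simp add: algebra_simps)

lemma higher_mersenne_gf_mult:
  assumes "k > 0"
  shows "higher_mersenne_gf k * ((fps_X - 1) * (fps_const (2 ^ k) * fps_X - 1)) = fps_X"
proof -
  define c :: rat where "c = 2 ^ k"
  let ?G = "higher_mersenne_gf k"
  have "c \<noteq> 1"
    unfolding c_def using one_less_power [of "2 :: rat" k] assms by linarith
  have rec: "higher_mersenne k (Suc (Suc n))
      = (c + 1) * higher_mersenne k (Suc n) - c * higher_mersenne k n" for n
    using higher_mersenne_Suc_Suc by (simp add: c_def)
  \<comment> \<open>Expanded this way, each factor \<open>fps_X\<close> is an index shift, so
    coefficients can be read off.\<close>
  have "?G * ((fps_X - 1) * (fps_const c * fps_X - 1))
      = fps_const c * (fps_X * (fps_X * ?G)) - fps_const (c + 1) * (fps_X * ?G) + ?G"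
    by (simp add: algebra_simps flip: fps_const_add)
  also have "\<dots> = fps_X"
  proof (rule fps_ext)
    fix n
    consider "n = 0" | "n = 1" | m where "n = Suc (Suc m)"
      by (metis One_nat_def not0_implies_Suc)
    then show "fps_nth (fps_const c * (fps_X * (fps_X * ?G)) - fps_const (c + 1) * (fps_X * ?G) + ?G) n
        = fps_nth fps_X n"
    proof cases
      case 1
      then show ?thesis
        by (simp add: higher_mersenne_gf_def higher_mersenne_eq)
    next
      case 2
      then show ?thesis
        \<comment> \<open>The coefficient is (c - 1)/(c - 1), which is 1 because
          \<open>k > 0\<close> excludes c = 1.\<close>
        using \<open>c \<noteq> 1\<close> by (simp add: higher_mersenne_gf_def higher_mersenne_eq c_def)
    next
      case 3
      then show ?thesis
        by (simp add: higher_mersenne_gf_def rec)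
    qed
  qed
  finally show ?thesis
    by (simp add: c_def)
qed

theorem theorem2p13:
  fixes k :: nat
  assumes "k > 0"
  shows "higher_mersenne_gf k
    = fps_X / ((fps_X - 1) * (fps_const (2 ^ k) * fps_X - 1))"
proof -
  let ?D = "(fps_X - 1) * (fps_const (2 ^ k) * fps_X - 1) :: rat fps"
  \<comment> \<open>If \<open>?D\<close> were 0, its product with the series would be 0 rather than
    \<open>fps_X\<close>.\<close>
  have "?D \<noteq> 0"
    using higher_mersenne_gf_mult [OF assms] by (metis fps_X_neq_zero mult_zero_right)
  then show ?thesis
    by (metis higher_mersenne_gf_mult [OF assms] nonzero_mult_div_cancel_right)
qed

end
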